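(* Let $K$ be a commutative ring, $R$ a $K$-algebra, $(X,\leqslant)$ a finite connected partially ordered set, $A=I(X,R)$ its incidence algebra over $R$, and $\mathcal T$ a fixed spanning tree of the graph of $X$. Then $\mathrm{Mult}\,A=\mathrm{Mult}_0\,A$ if and only if every $\psi\in\mathrm{Mult}\,A$ such that $\psi(e_{xy})=e_{xy}$ for all edges $(x,y)$ of $\mathcal T$ with $x<y$ satisfies $\psi=1$ (the identity automorphism).
   Context: All rings are associative with a nonzero identity element. The graph of a finite partially ordered set $X$ is the simple graph with vertex set $X$ in which two distinct elements are joined by an edge iff they are comparable (all comparable pairs, not only covering pairs); $X$ is connected if this graph is connected. The incidence algebra is $I(X,R)=\{f\colon X\times X\to R \mid f(x,y)=0 \text{ if } x\not\leqslant y\}$ with pointwise addition and $K$-action and product $(fg)(x,y)=\sum_{x\leqslant z\leqslant y}f(x,z)g(z,y)$; it is a $K$-algebra. Put $A=I(X,R)$, $L=\{f\in A\mid f(x,y)=0 \text{ if } x\neq y\}$ (a subring) and $M=\{f\in A\mid f(x,x)=0 \text{ for all } x\in X\}$ (an ideal), so $A=L\oplus M$ as $K$-modules. For $x<y$ in $X$, $e_{xy}\in A$ is the function with $e_{xy}(x,y)=1$ and value $0$ on all other pairs. A $K$-algebra automorphism $\varphi$ of $A$ is multiplicative if $\varphi(a+c)=a+\beta(c)$ for all $a\in L$, $c\in M$, for some map $\beta\colon M\to M$; these form the group $\mathrm{Mult}\,A$. An automorphism of $A$ is fractional if it has the form $a\mapsto v^{-1}av$ with $v$ an invertible central element of the ring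 $L$; these form the subgroup $\mathrm{Mult}_0\,A\subseteq\mathrm{Mult}\,A$. *)

theory Defs
  imports Main "Graph_Theory.Digraph_Component"
begin

section \<open>Algebras over a commutative ring\<close>

text \<open>Associative, unital, not necessarily commutative; class \<open>ring_1\<close> includes \<open>0 \<noteq> 1\<close>.\<close>

locale ring_algebra = module scale
  for scale :: "'k::comm_ring_1 \<Rightarrow> 'a::ring_1 \<Rightarrow> 'a" +
  assumes scale_mult_left: "scale k (a * b) = scale k a * b"
    and scale_mult_right: "scale k (a * b) = a * scale k b"

definition algebra_automorphisms :: "('k \<Rightarrow> 'a::ring_1 \<Rightarrow> 'a) \<Rightarrow> ('a \<Rightarrow> 'a) set" where
  "algebra_automorphisms scale = {\<phi>. bij \<phi> \<and> \<phi> 1 = 1 \<and>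
     (\<forall>a b. \<phi> (a + b) = \<phi> a + \<phi> b) \<and>
     (\<forall>a b. \<phi> (a * b) = \<phi> a * \<phi> b) \<and>
     (\<forall>k a. \<phi> (scale k a) = scale k (\<phi> a))}"


section \<open>The incidence algebra of a finite poset\<close>

typedef (overloaded) ('x::order, 'r::zero) incidence =
  "{f :: 'x \<Rightarrow> 'x \<Rightarrow> 'r. \<forall>x y. \<not> x \<le> y \<longrightarrow> f x y = 0}"
  morphisms entry Incidence
  by (rule exI[of _ "\<lambda>_ _. 0"]) simp

setup_lifting type_definition_incidence

lemma incidence_eqI: "(\<And>x y. entry f x y = entry g x y) \<Longrightarrow> f = g"
  by (metis entry_inject ext)

lemma entry_eq_0: "\<not> x \<le> y \<Longrightarrow> entry f x y = 0"
  using entry[of f] by simp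

instantiation incidence :: (order, ab_group_add) ab_group_add
begin

lift_definition zero_incidence :: "('a, 'b) incidence" is "\<lambda>_ _. 0"
  by simp

lift_definition plus_incidence :: "('a, 'b) incidence \<Rightarrow> ('a, 'b) incidence \<Rightarrow> ('a, 'b) incidence"
  is "\<lambda>f g x y. f x y + g x y"
  by simp

lift_definition uminus_incidence :: "('a, 'b) incidence \<Rightarrow> ('a, 'b) incidence"
  is "\<lambda>f x y. - f x y"
  by simp

lift_definition minus_incidence :: "('a, 'b) incidence \<Rightarrow> ('a, 'b) incidence \<Rightarrow> ('a, 'b) incidence"
  is "\<lambda>f g x y. f x y - g x y"
  by simp

instance
  by standard (transfer; simp add: fun_eq_iff algebra_simps)+

end

instantiation incidence :: ("{finite, order}", ring_1) ring_1
begin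

lift_definition one_incidence :: "('a, 'b) incidence" is "\<lambda>x y. if x = y then 1 else 0"
  by simp

lift_definition times_incidence :: "('a, 'b) incidence \<Rightarrow> ('a, 'b) incidence \<Rightarrow> ('a, 'b) incidence"
  is "\<lambda>f g x y. \<Sum>z\<in>{x..y}. f x z * g z y"
  by simp

lemma entry_times_UNIV:
  fixes f g :: "('a, 'b) incidence"
  shows "entry (f * g) x y = (\<Sum>z\<in>UNIV. entry f x z * entry g z y)"
  unfolding times_incidence.rep_eq
  by (rule sum.mono_neutral_left) (auto simp: entry_eq_0)

instance
proof
  fix a b c :: "('a, 'b) incidence"
  show "a * b * c = a * (b * c)"
  proof (rule incidence_eqI)
    fix x y
    have "entry (a * b * c) x y
        = (\<Sum>z\<in>UNIV. \<Sum>w\<in>UNIV. entry a x w * entry b w z * entry c z y)"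
      by (simp add: entry_times_UNIV sum_distrib_right)
    also have "\<dots> = (\<Sum>w\<in>UNIV. \<Sum>z\<in>UNIV. entry a x w * entry b w z * entry c z y)"
      by (rule sum.swap)
    also have "\<dots> = entry (a * (b * c)) x y"
      by (simp add: entry_times_UNIV sum_distrib_left mult.assoc)
    finally show "entry (a * b * c) x y = entry (a * (b * c)) x y" .
  qed
  show "1 * a = a"
  proof (rule incidence_eqI)
    fix x y
    have "entry (1 * a) x y = (\<Sum>z\<in>UNIV. if x = z then entry a z y else 0)"
      unfolding entry_times_UNIV one_incidence.rep_eq by (rule sum.cong) auto
    then show "entry (1 * a) x y = entry a x y" by simp
  qed
  show "a * 1 = a"
  proof (rule incidence_eqI)
    fix x y
    have "entry (a * 1) x y = (\<Sum>z\<in>UNIV. if z = y then entry a x z else 0)"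
      unfolding entry_times_UNIV one_incidence.rep_eq by (rule sum.cong) auto
    then show "entry (a * 1) x y = entry a x y" by simp
  qed
  show "(a + b) * c = a * c + b * c"
    by (rule incidence_eqI)
      (simp add: entry_times_UNIV plus_incidence.rep_eq distrib_right sum.distrib)
  show "a * (b + c) = a * b + a * c"
    by (rule incidence_eqI)
      (simp add: entry_times_UNIV plus_incidence.rep_eq distrib_left sum.distrib)
  show "(0 :: ('a, 'b) incidence) \<noteq> 1"
  proof
    assume "(0 :: ('a, 'b) incidence) = 1"
    then have "entry (0 :: ('a, 'b) incidence) x x = entry 1 x x" for x by simp
    then show False by (simp add: zero_incidence.rep_eq one_incidence.rep_eq)
  qed
qed

end

text \<open>The guard on \<open>scale k 0\<close> is only there to make the operation total for an arbitrary
  \<open>scale\<close>: in a module \<open>scale k 0 = 0\<close>, so this is the pointwise action.\<close>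

lift_definition incidence_scale ::
  "('k \<Rightarrow> 'r \<Rightarrow> 'r) \<Rightarrow> 'k \<Rightarrow> ('x::order, 'r::zero) incidence \<Rightarrow> ('x, 'r) incidence"
  is "\<lambda>scale k f x y. if x \<le> y then scale k (f x y) else 0"
  by simp

lemma (in module) entry_incidence_scale:
  "entry (incidence_scale scale k f) x y = scale k (entry f x y)"
  by (simp add: incidence_scale.rep_eq entry_eq_0)

lemma (in ring_algebra) ring_algebra_incidence:
  "ring_algebra (incidence_scale scale :: 'k \<Rightarrow> ('x::{finite, order}, 'a) incidence \<Rightarrow> _)"
proof unfold_locales
  fix k l :: 'k and f g :: "('x, 'a) incidence"
  let ?s = "incidence_scale scale :: 'k \<Rightarrow> ('x, 'a) incidence \<Rightarrow> _"
  show "?s k (f + g) = ?s k f + ?s k g" "?s (k + l) f = ?s k f + ?s l f"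
    by (simp_all add: incidence_eqI entry_incidence_scale plus_incidence.rep_eq
        scale_right_distrib scale_left_distrib)
  show "?s k (?s l f) = ?s (k * l) f" "?s 1 f = f"
    by (simp_all add: incidence_eqI entry_incidence_scale)
  show "?s k (f * g) = ?s k f * g"
    by (simp add: incidence_eqI entry_incidence_scale entry_times_UNIV
        scale_sum_right flip: scale_mult_left)
  show "?s k (f * g) = f * ?s k g"
    by (simp add: incidence_eqI entry_incidence_scale entry_times_UNIV
        scale_sum_right flip: scale_mult_right)
qed

text \<open>The guard \<open>x \<le> y\<close> only serves totality; the element is used for \<open>x < y\<close>.\<close>

lift_definition incidence_unit :: "'x::order \<Rightarrow> 'x \<Rightarrow> ('x, 'r::ring_1) incidence"
  is "\<lambda>x y u v. if x \<le> y \<and> u = x \<and> v = y then 1 else 0"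
  by auto

definition diagonal_part :: "('x::order, 'r::zero) incidence set" where
  "diagonal_part = {f. \<forall>x y. x \<noteq> y \<longrightarrow> entry f x y = 0}"

definition strict_part :: "('x::order, 'r::zero) incidence set" where
  "strict_part = {f. \<forall>x. entry f x x = 0}"


section \<open>Multiplicative and fractional automorphisms\<close>

definition multiplicative_automorphisms ::
  "('k \<Rightarrow> 'r \<Rightarrow> 'r) \<Rightarrow>
    (('x::{finite, order}, 'r::ring_1) incidence \<Rightarrow> ('x, 'r) incidence) set" where
  "multiplicative_automorphisms scale =
    {\<phi> \<in> algebra_automorphisms (incidence_scale scale).
      \<exists>\<beta>. (\<forall>c \<in> strict_part. \<beta> c \<in> strict_part) \<and>
          (\<forall>a \<in> diagonal_part. \<forall>c \<in> strict_part. \<phi> (a + c) = a + \<beta> c)}"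

definition fractional_automorphisms ::
  "('k \<Rightarrow> 'r \<Rightarrow> 'r) \<Rightarrow>
    (('x::{finite, order}, 'r::ring_1) incidence \<Rightarrow> ('x, 'r) incidence) set" where
  "fractional_automorphisms scale =
    {\<phi> \<in> algebra_automorphisms (incidence_scale scale).
      \<exists>v \<in> diagonal_part. \<exists>v' \<in> diagonal_part.
        v * v' = 1 \<and> v' * v = 1 \<and> (\<forall>l \<in> diagonal_part. v * l = l * v) \<and>
        \<phi> = (\<lambda>a. v' * a * v)}"


section \<open>The graph of a poset and its spanning trees\<close>

text \<open>A simple graph is a symmetric loop-free digraph (locale \<open>pair_graph\<close>): an edge joining
  \<open>x\<close> and \<open>y\<close> is the pair of arcs \<open>(x, y)\<close>, \<open>(y, x)\<close>.\<close>

definition poset_graph :: "'x::order pair_pre_digraph" where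
  "poset_graph = \<lparr>pverts = UNIV, parcs = {(x, y). x \<noteq> y \<and> (x \<le> y \<or> y \<le> x)}\<rparr>"

text \<open>The library predicate \<open>spanning_tree\<close> excludes all directed cycles, hence also the closed
  walks \<open>x, y, x\<close> along a single edge of a symmetric digraph, so no symmetric digraph with an edge
  satisfies it. The cycles of a simple graph are the cycles of length at least 3.\<close>

definition graph_spanning_tree :: "'x pair_pre_digraph \<Rightarrow> 'x pair_pre_digraph \<Rightarrow> bool" where
  "graph_spanning_tree T G \<longleftrightarrow> pair_graph T \<and> spanning (with_proj T) (with_proj G) \<and>
     Digraph_Component.connected (with_proj T) \<and>
     \<not> (\<exists>p. pre_digraph.cycle (with_proj T) p \<and> 3 \<le> length p)"

end

theory Submission
  imports Defs
begin

text \<open>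
  A multiplicative automorphism \<open>\<psi>\<close> fixes the diagonal idempotents, so it maps \<open>e\<^sub>x\<^sub>y\<close> to a multiple
  \<open>c\<^sub>x\<^sub>y e\<^sub>x\<^sub>y\<close>, and it is determined by these factors: it scales the entry at \<open>(x, y)\<close> of every element
  by \<open>c\<^sub>x\<^sub>y\<close>. Since \<open>\<psi>\<close> also fixes the scalar diagonal elements, each \<open>c\<^sub>x\<^sub>y\<close> is central in \<open>R\<close>,
  and surjectivity makes it a unit. The automorphism is fractional precisely when the factors form a
  coboundary, \<open>c\<^sub>x\<^sub>y = v\<^sub>x\<^sup>-\<^sup>1 v\<^sub>y\<close>, for a family of central units \<open>v\<^sub>x\<close>.

  On a spanning tree a coboundary carries no obstruction and no freedom. There is no freedom because
  a family \<open>v\<close> whose coboundary is trivial along the edges of a connected spanning subgraph is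
  constant, so a fractional automorphism that fixes the tree edges is the identity. There is no
  obstruction because in a tree every closed walk backtracks, so arbitrary invertible factors
  prescribed on the edges are the coboundary of the family obtained by multiplying them along walks
  from a root (\<open>tree_potential\<close>). Hence every \<open>\<psi>\<close> in \<open>Mult A\<close> is a fractional automorphism times a
  multiplicative automorphism that fixes the tree edges
  (\<open>multiplicative_automorphism_tree_normalization\<close>), and both implications follow.
\<close>

section \<open>Potentials on trees\<close>

text \<open>In a graph without cycles, a nonempty closed walk that repeats no inner vertex goes along one
  edge and back. Every other closed walk splits at a repeated vertex into two shorter ones.\<close>

lemma (in pair_graph) closed_walk_gain_eq_1:
  fixes g :: "'a \<times> 'a \<Rightarrow> 'm::monoid_mult"
  assumes acyclic: "\<nexists>p. cycle p \<and> 3 \<le> length p"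
    and inv: "\<And>x y. (x, y) \<in> parcs G \<Longrightarrow> g (x, y) * g (y, x) = 1"
    and "awalk u p u"
  shows "prod_list (map g p) = 1"
  using \<open>awalk u p u\<close>
proof (induction "length p" arbitrary: u p rule: less_induct)
  case less
  show ?case
  proof (cases p)
    case Nil
    then show ?thesis by simp
  next
    case (Cons e p')
    have e: "e \<in> parcs G" "fst e = u" and p': "awalk (snd e) p' u"
      using less.prems Cons by (auto simp: awalk_Cons_iff)
    show ?thesis
    proof (cases "distinct (awalk_verts (snd e) p')")
      case True
      then have "cycle p"
        using less.prems Cons by (auto simp: cycle_def)
      with acyclic have "length p' \<le> 1"
        using Cons by fastforce
      then consider "p' = []" | e' where "p' = [e']"
        by (cases p') auto
      then show ?thesis
      proof cases
        case 1
        with p' e no_loops show ?thesis by fastforce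
      next
        case 2
        then have "fst e' = snd e" "snd e' = u"
          using p' by (auto simp: awalk_Cons_iff awalk_Nil_iff)
        then have "e' = (snd e, fst e)" "e = (fst e, snd e)"
          using e by (auto simp: prod_eq_iff)
        then have "g e * g e' = 1"
          using inv e by metis
        then show ?thesis
          using Cons 2 by simp
      qed
    next
      case False
      then obtain q r s w where p'_eq: "p' = q @ r @ s" and "r \<noteq> []"
        and q: "awalk (snd e) q w" and r: "awalk w r w" and s: "awalk w s u"
        using awalk_not_distinct_decomp[OF p'] by auto
      have "awalk u (e # q @ s) u"
        using e q s less.prems Cons by (auto simp: awalk_Cons_iff)
      then have "prod_list (map g (e # q @ s)) = 1"
        using \<open>r \<noteq> []\<close> Cons p'_eq by (intro less.hyps) auto
      moreover have "prod_list (map g r) = 1"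
        using Cons p'_eq r by (intro less.hyps[of r w]) auto
      ultimately show ?thesis
        using Cons p'_eq by simp
    qed
  qed
qed

text \<open>The potential of a vertex is the product of the factors along a walk from a root. Comparing
  with a walk back to the root shows that the choice of the walk does not matter. The set \<open>S\<close> records
  that the potential stays in any submonoid that contains the factors.\<close>

lemma (in pair_graph) tree_potential:
  fixes g :: "'a \<times> 'a \<Rightarrow> 'm::monoid_mult"
  assumes conn: "Digraph_Component.connected (with_proj G)"
    and acyclic: "\<nexists>p. cycle p \<and> 3 \<le> length p"
    and inv: "\<And>x y. (x, y) \<in> parcs G \<Longrightarrow> g (x, y) * g (y, x) = 1"
    and S: "1 \<in> S" "\<And>a b. a \<in> S \<Longrightarrow> b \<in> S \<Longrightarrow> a * b \<in> S" "\<And>e. e \<in> parcs G \<Longrightarrow> g e \<in> S"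
  obtains v w where "\<forall>x \<in> pverts G. v x \<in> S \<and> w x \<in> S \<and> v x * w x = 1 \<and> w x * v x = 1"
    "\<forall>(x, y) \<in> parcs G. v y = v x * g (x, y)"
proof -
  define gain where "gain p = prod_list (map g p)" for p
  have closed: "gain p = 1" if "awalk u p u" for u p
    unfolding gain_def using closed_walk_gain_eq_1[where g = g, OF acyclic inv that] .
  have gain_S: "gain p \<in> S" if "set p \<subseteq> parcs G" for p
    using that by (induction p) (auto simp: gain_def S)
  have reach: "x \<rightarrow>\<^sup>*\<^bsub>with_proj G\<^esub> y" if "x \<in> pverts G" "y \<in> pverts G" for x y
    using conn that reachable_mk_symmetric_eq[OF sym_arcs]
    by (auto simp: connected_def strongly_connected_def)
  obtain root where root: "root \<in> pverts G"
    using conn by (auto simp: connected_def strongly_connected_def)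
  have "\<exists>p. awalk root p x" "\<exists>q. awalk x q root" if "x \<in> pverts G" for x
    using reach root that by (auto simp: reachable_awalk)
  then obtain p q where p: "\<And>x. x \<in> pverts G \<Longrightarrow> awalk root (p x) x"
    and q: "\<And>x. x \<in> pverts G \<Longrightarrow> awalk x (q x) root"
    by metis
  have pq: "gain (p x) * gain (q x) = 1" if "x \<in> pverts G" for x
  proof -
    have "awalk root (p x @ q x) root"
      using p[OF that] q[OF that] by auto
    from closed[OF this] show ?thesis by (simp add: gain_def)
  qed
  have qp: "gain (q x) * gain (p x) = 1" if "x \<in> pverts G" for x
  proof -
    have "awalk x (q x @ p x) x"
      using p[OF that] q[OF that] by auto
    from closed[OF this] show ?thesis by (simp add: gain_def)
  qed
  have "gain (p x) \<in> S" "gain (q x) \<in> S" if "x \<in> pverts G" for x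
    using p[OF that] q[OF that] gain_S by (auto simp: awalk_def)
  moreover have "gain (p y) = gain (p x) * g (x, y)" if xy: "(x, y) \<in> parcs G" for x y
  proof -
    have x: "x \<in> pverts G" and y: "y \<in> pverts G"
      using xy wellformed by fastforce+
    have "awalk root (p x @ (x, y) # q y) root"
      using p[OF x] q[OF y] xy x by (auto simp: awalk_Cons_iff)
    from closed[OF this] have "gain (p x) * g (x, y) * gain (q y) = 1"
      by (simp add: gain_def mult.assoc)
    then have "gain (p x) * g (x, y) * (gain (q y) * gain (p y)) = gain (p y)"
      by (metis mult.assoc mult_1)
    then show ?thesis
      using qp[OF y] by simp
  qed
  ultimately show thesis
    using pq qp by (intro that[of "\<lambda>x. gain (p x)" "\<lambda>x. gain (q x)"]) auto
qed

lemma (in pair_graph) connected_imp_constant: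
  assumes conn: "Digraph_Component.connected (with_proj G)"
    and step: "\<And>x y. (x, y) \<in> parcs G \<Longrightarrow> f x = f y"
    and "x \<in> pverts G" "y \<in> pverts G"
  shows "f x = f y"
proof -
  have "x \<rightarrow>\<^sup>*\<^bsub>with_proj G\<^esub> y"
    using conn assms(3,4) reachable_mk_symmetric_eq[OF sym_arcs]
    by (auto simp: connected_def strongly_connected_def)
  then show ?thesis
  proof (induction rule: reachable_induct)
    case (step y z)
    then have "f y = f z"
      using assms(2) by simp
    with step.IH show ?case by simp
  qed simp
qed


section \<open>Diagonal elements\<close>

lift_definition diagonal :: "('x \<Rightarrow> 'r) \<Rightarrow> ('x::order, 'r::zero) incidence"
  is "\<lambda>d x y. if x = y then d x else 0"
  by auto

lemma diagonal_in_diagonal_part [simp]: "diagonal d \<in> diagonal_part"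
  by (simp add: diagonal_part_def diagonal.rep_eq)

lemma diagonal_part_eq_diagonal: "f \<in> diagonal_part \<Longrightarrow> f = diagonal (\<lambda>x. entry f x x)"
  by (rule incidence_eqI) (auto simp: diagonal_part_def diagonal.rep_eq)

lemma entry_diagonal_times:
  fixes f :: "('x::{finite, order}, 'r::ring_1) incidence"
  shows "entry (diagonal d * f) x y = d x * entry f x y"
proof -
  have "entry (diagonal d * f) x y = (\<Sum>z\<in>UNIV. if x = z then d x * entry f z y else 0)"
    unfolding entry_times_UNIV diagonal.rep_eq by (rule sum.cong) auto
  then show ?thesis by simp
qed

lemma entry_times_diagonal:
  fixes f :: "('x::{finite, order}, 'r::ring_1) incidence"
  shows "entry (f * diagonal d) x y = entry f x y * d y"
proof -
  have "entry (f * diagonal d) x y = (\<Sum>z\<in>UNIV. if z = y then entry f x z * d z else 0)"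
    unfolding entry_times_UNIV diagonal.rep_eq by (rule sum.cong) auto
  then show ?thesis by simp
qed

lemma diagonal_times_diagonal:
  fixes d :: "'x::{finite, order} \<Rightarrow> 'r::ring_1"
  shows "diagonal d * diagonal d' = diagonal (\<lambda>x. d x * d' x)"
  by (rule incidence_eqI) (simp add: entry_diagonal_times diagonal.rep_eq)

lemma diagonal_eq_1_iff:
  fixes d :: "'x::{finite, order} \<Rightarrow> 'r::ring_1"
  shows "diagonal d = 1 \<longleftrightarrow> (\<forall>x. d x = 1)"
proof
  assume "diagonal d = 1"
  then have "entry (diagonal d) x x = entry 1 x x" for x
    by simp
  then show "\<forall>x. d x = 1"
    by (simp add: diagonal.rep_eq one_incidence.rep_eq)
qed (auto intro!: incidence_eqI simp: diagonal.rep_eq one_incidence.rep_eq)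

lemma diagonal_central_imp_entry_central:
  fixes v :: "('x::{finite, order}, 'r::ring_1) incidence"
  assumes "\<forall>l \<in> diagonal_part. v * l = l * v"
  shows "entry v x x * r = r * entry v x x"
proof -
  have "entry (v * diagonal (\<lambda>_. r)) x x = entry (diagonal (\<lambda>_. r) * v) x x"
    using assms by simp
  then show ?thesis
    by (simp add: entry_diagonal_times entry_times_diagonal)
qed


section \<open>Multiplicative automorphisms\<close>

text \<open>The map \<open>\<beta>\<close> of the definition is the restriction of \<open>\<phi>\<close> to the strict part, so it can be
  eliminated.\<close>

lemma multiplicative_automorphisms_iff:
  fixes \<phi> :: "('x::{finite, order}, 'r::ring_1) incidence \<Rightarrow> ('x, 'r) incidence"
  shows "\<phi> \<in> multiplicative_automorphisms scale \<longleftrightarrow>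
    \<phi> \<in> algebra_automorphisms (incidence_scale scale) \<and>
    (\<forall>a \<in> diagonal_part. \<phi> a = a) \<and> \<phi> ` strict_part \<subseteq> strict_part"
proof
  assume "\<phi> \<in> multiplicative_automorphisms scale"
  then obtain \<beta> where aut: "\<phi> \<in> algebra_automorphisms (incidence_scale scale)"
    and \<beta>: "\<forall>c \<in> strict_part. \<beta> c \<in> strict_part"
    and \<phi>: "\<forall>a \<in> diagonal_part. \<forall>c \<in> strict_part. \<phi> (a + c) = a + \<beta> c"
    by (auto simp: multiplicative_automorphisms_def)
  have add: "\<phi> (a + b) = \<phi> a + \<phi> b" for a b
    using aut by (simp add: algebra_automorphisms_def)
  have zero: "0 \<in> (diagonal_part :: ('x, 'r) incidence set)"
      "0 \<in> (strict_part :: ('x, 'r) incidence set)"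
    by (simp_all add: diagonal_part_def strict_part_def zero_incidence.rep_eq)
  have "\<phi> 0 = 0"
    using add[of 0 0] by simp
  then have "\<beta> 0 = 0"
    using \<phi> zero by fastforce
  then have "\<phi> a = a" if "a \<in> diagonal_part" for a
    using \<phi> zero that by fastforce
  moreover have "\<phi> c = \<beta> c" if "c \<in> strict_part" for c
    using \<phi> zero that by fastforce
  ultimately show "\<phi> \<in> algebra_automorphisms (incidence_scale scale) \<and>
    (\<forall>a \<in> diagonal_part. \<phi> a = a) \<and> \<phi> ` strict_part \<subseteq> strict_part"
    using aut \<beta> by auto
next
  assume "\<phi> \<in> algebra_automorphisms (incidence_scale scale) \<and>
    (\<forall>a \<in> diagonal_part. \<phi> a = a) \<and> \<phi> ` strict_part \<subseteq> strict_part"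
  then show "\<phi> \<in> multiplicative_automorphisms scale"
    unfolding multiplicative_automorphisms_def algebra_automorphisms_def
    by (auto intro!: exI[of _ \<phi>])
qed

lemma multiplicative_automorphisms_comp:
  assumes "\<phi> \<in> multiplicative_automorphisms scale" "\<psi> \<in> multiplicative_automorphisms scale"
  shows "\<phi> \<circ> \<psi> \<in> multiplicative_automorphisms scale"
proof -
  have "\<phi> \<circ> \<psi> \<in> algebra_automorphisms (incidence_scale scale)"
    using assms
    by (auto simp: multiplicative_automorphisms_iff algebra_automorphisms_def intro: bij_comp)
  moreover have "\<forall>a \<in> diagonal_part. (\<phi> \<circ> \<psi>) a = a" "(\<phi> \<circ> \<psi>) ` strict_part \<subseteq> strict_part"
    using assms by (auto simp: multiplicative_automorphisms_iff image_subset_iff)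
  ultimately show ?thesis
    by (simp add: multiplicative_automorphisms_iff)
qed

text \<open>The factor \<open>c\<^sub>x\<^sub>y\<close> by which a multiplicative automorphism scales the entries at \<open>(x, y)\<close>;
  it is \<open>0\<close> unless \<open>x \<le> y\<close>.\<close>

definition multiplier ::
  "(('x::order, 'r::ring_1) incidence \<Rightarrow> ('x, 'r) incidence) \<Rightarrow> 'x \<Rightarrow> 'x \<Rightarrow> 'r" where
  "multiplier \<psi> x y = entry (\<psi> (incidence_unit x y)) x y"

text \<open>The diagonal idempotents at \<open>x\<close> and \<open>y\<close> cut out of \<open>f\<close> the single entry at \<open>(x, y)\<close>, which is
  also a scalar diagonal element times \<open>e\<^sub>x\<^sub>y\<close>. A homomorphism that fixes the diagonal elements
  respects both descriptions.\<close>

lemma entry_multiplicative_automorphism: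
  fixes \<psi> :: "('x::{finite, order}, 'r::ring_1) incidence \<Rightarrow> ('x, 'r) incidence"
  assumes "\<psi> \<in> multiplicative_automorphisms scale"
  shows "entry (\<psi> f) x y = entry f x y * multiplier \<psi> x y"
proof (cases "x \<le> y")
  case False
  then show ?thesis by (simp add: entry_eq_0)
next
  case True
  have mult: "\<psi> (a * b) = \<psi> a * \<psi> b" for a b
    using assms by (simp add: multiplicative_automorphisms_iff algebra_automorphisms_def)
  have diag: "\<psi> (diagonal d) = diagonal d" for d
    using assms by (simp add: multiplicative_automorphisms_iff)
  define idem :: "'x \<Rightarrow> ('x, 'r) incidence"
    where "idem z = diagonal (\<lambda>u. if u = z then 1 else 0)" for z
  have "idem x * f * idem y = diagonal (\<lambda>_. entry f x y) * incidence_unit x y"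
    using True by (intro incidence_eqI)
      (auto simp: idem_def entry_diagonal_times entry_times_diagonal incidence_unit.rep_eq)
  then have "\<psi> (idem x * f * idem y) = \<psi> (diagonal (\<lambda>_. entry f x y) * incidence_unit x y)"
    by simp
  then have "idem x * \<psi> f * idem y = diagonal (\<lambda>_. entry f x y) * \<psi> (incidence_unit x y)"
    by (simp add: mult diag idem_def)
  then have "entry (idem x * \<psi> f * idem y) x y
      = entry (diagonal (\<lambda>_. entry f x y) * \<psi> (incidence_unit x y)) x y"
    by simp
  then show ?thesis
    by (simp add: idem_def entry_diagonal_times entry_times_diagonal multiplier_def)
qed

text \<open>Because \<open>r e\<^sub>x\<^sub>y = e\<^sub>x\<^sub>y r\<close>, and \<open>\<psi>\<close> fixes the scalar diagonal element \<open>r\<close>.\<close>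

lemma multiplier_central:
  fixes \<psi> :: "('x::{finite, order}, 'r::ring_1) incidence \<Rightarrow> ('x, 'r) incidence"
  assumes "\<psi> \<in> multiplicative_automorphisms scale"
  shows "r * multiplier \<psi> x y = multiplier \<psi> x y * r"
proof -
  have mult: "\<psi> (a * b) = \<psi> a * \<psi> b" for a b
    using assms by (simp add: multiplicative_automorphisms_iff algebra_automorphisms_def)
  have diag: "\<psi> (diagonal d) = diagonal d" for d
    using assms by (simp add: multiplicative_automorphisms_iff)
  have "diagonal (\<lambda>_. r) * incidence_unit x y = incidence_unit x y * diagonal (\<lambda>_::'x. r)"
    by (rule incidence_eqI)
      (simp add: entry_diagonal_times entry_times_diagonal incidence_unit.rep_eq)
  then have "\<psi> (diagonal (\<lambda>_. r) * incidence_unit x y) = \<psi> (incidence_unit x y * diagonal (\<lambda>_. r))"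
    by simp
  then have "entry (diagonal (\<lambda>_. r) * \<psi> (incidence_unit x y)) x y
      = entry (\<psi> (incidence_unit x y) * diagonal (\<lambda>_. r)) x y"
    by (simp add: mult diag)
  then show ?thesis
    by (simp add: entry_diagonal_times entry_times_diagonal multiplier_def)
qed

text \<open>An inverse is read off a preimage of \<open>e\<^sub>x\<^sub>y\<close>.\<close>

lemma multiplier_left_inverse:
  fixes \<psi> :: "('x::{finite, order}, 'r::ring_1) incidence \<Rightarrow> ('x, 'r) incidence"
  assumes "\<psi> \<in> multiplicative_automorphisms scale" and "x \<le> y"
  shows "\<exists>d. d * multiplier \<psi> x y = 1"
proof -
  have "surj \<psi>"
    using assms by (simp add: multiplicative_automorphisms_iff algebra_automorphisms_def bij_def)
  then obtain f where f: "\<psi> f = incidence_unit x y"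
    by (metis surjD)
  have "entry f x y * multiplier \<psi> x y = entry (incidence_unit x y) x y"
    using entry_multiplicative_automorphism[OF assms(1), of f x y] f by simp
  then show ?thesis
    using \<open>x \<le> y\<close> by (auto simp: incidence_unit.rep_eq)
qed

lemma multiplicative_automorphism_fixes_unit_iff:
  fixes \<psi> :: "('x::{finite, order}, 'r::ring_1) incidence \<Rightarrow> ('x, 'r) incidence"
  assumes "\<psi> \<in> multiplicative_automorphisms scale" and "x \<le> y"
  shows "\<psi> (incidence_unit x y) = incidence_unit x y \<longleftrightarrow> multiplier \<psi> x y = 1"
proof
  assume "\<psi> (incidence_unit x y) = incidence_unit x y"
  then show "multiplier \<psi> x y = 1"
    using \<open>x \<le> y\<close> by (simp add: multiplier_def incidence_unit.rep_eq)
next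
  assume "multiplier \<psi> x y = 1"
  then show "\<psi> (incidence_unit x y) = incidence_unit x y"
    by (intro incidence_eqI)
      (simp add: entry_multiplicative_automorphism[OF assms(1)] incidence_unit.rep_eq)
qed


section \<open>Fractional automorphisms\<close>

lemma (in ring_algebra) inner_automorphism:
  assumes "v * v' = 1" "v' * v = 1"
  shows "(\<lambda>a. v' * a * v) \<in> algebra_automorphisms scale"
proof -
  have "bij (\<lambda>a. v' * a * v)"
  proof (rule o_bij[of "\<lambda>a. v * a * v'"])
    show "(\<lambda>a. v * a * v') \<circ> (\<lambda>a. v' * a * v) = id"
      using assms by (simp add: fun_eq_iff mult.assoc) (simp flip: mult.assoc)
    show "(\<lambda>a. v' * a * v) \<circ> (\<lambda>a. v * a * v') = id"
      using assms by (simp add: fun_eq_iff mult.assoc) (simp flip: mult.assoc)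
  qed
  moreover have "v' * (a * b) * v = (v' * a * v) * (v' * b * v)" for a b
    by (metis assms(1) mult.assoc mult_1)
  ultimately show ?thesis
    using assms by (simp add: algebra_automorphisms_def algebra_simps
        flip: scale_mult_left scale_mult_right)
qed

lemma fractional_automorphisms_subset:
  "(fractional_automorphisms scale ::
      (('x::{finite, order}, 'r::ring_1) incidence \<Rightarrow> ('x, 'r) incidence) set)
    \<subseteq> multiplicative_automorphisms scale"
proof
  fix \<phi> :: "('x, 'r) incidence \<Rightarrow> ('x, 'r) incidence"
  assume "\<phi> \<in> fractional_automorphisms scale"
  then obtain v v' where aut: "\<phi> \<in> algebra_automorphisms (incidence_scale scale)"
    and v: "v \<in> diagonal_part" "v' \<in> diagonal_part" "v' * v = 1"
      "\<forall>l \<in> diagonal_part. v * l = l * v"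
    and \<phi>: "\<phi> = (\<lambda>a. v' * a * v)"
    by (auto simp: fractional_automorphisms_def)
  have "\<phi> a = a" if "a \<in> diagonal_part" for a
    using v that by (metis \<phi> mult.assoc mult_1)
  moreover have "\<phi> c \<in> strict_part" if "c \<in> strict_part" for c
  proof -
    obtain d d' where "v = diagonal d" "v' = diagonal d'"
      using diagonal_part_eq_diagonal v(1,2) by blast
    then show ?thesis
      using that by (simp add: \<phi> strict_part_def entry_diagonal_times entry_times_diagonal)
  qed
  ultimately show "\<phi> \<in> multiplicative_automorphisms scale"
    using aut by (auto simp: multiplicative_automorphisms_iff)
qed

lemma (in ring_algebra) conjugation_in_fractional_automorphisms:
  fixes v w :: "'x::{finite, order} \<Rightarrow> 'a"
  assumes "\<And>x. v x * w x = 1" "\<And>x. w x * v x = 1" and central: "\<And>x r. v x * r = r * v x"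
  shows "(\<lambda>a. diagonal w * a * diagonal v) \<in> fractional_automorphisms scale"
proof -
  interpret A: ring_algebra "incidence_scale scale :: 'k \<Rightarrow> ('x, 'a) incidence \<Rightarrow> _"
    by (rule ring_algebra_incidence)
  have inv: "diagonal v * diagonal w = 1" "diagonal w * diagonal v = 1"
    using assms by (simp_all add: diagonal_times_diagonal diagonal_eq_1_iff)
  have "diagonal v * l = l * diagonal v" if "l \<in> diagonal_part" for l
    by (subst (1 2) diagonal_part_eq_diagonal[OF that])
      (simp add: diagonal_times_diagonal central)
  then show ?thesis
    unfolding fractional_automorphisms_def
    using A.inner_automorphism[OF inv] inv diagonal_in_diagonal_part by blast
qed

text \<open>Conjugation by a diagonal element is trivial as soon as its diagonal is constant and central,
  and the edges of a connected spanning subgraph force it to be constant.\<close>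

lemma fractional_automorphism_fixing_connected_eq_id:
  fixes \<psi> :: "('x::{finite, order}, 'r::ring_1) incidence \<Rightarrow> ('x, 'r) incidence"
  assumes "pair_graph T" "Digraph_Component.connected (with_proj T)" "pverts T = UNIV"
    and comparable: "\<And>x y. (x, y) \<in> parcs T \<Longrightarrow> x < y \<or> y < x"
    and \<psi>: "\<psi> \<in> fractional_automorphisms scale"
    and fixed: "\<And>x y. (x, y) \<in> parcs T \<Longrightarrow> x < y \<Longrightarrow> \<psi> (incidence_unit x y) = incidence_unit x y"
  shows "\<psi> = id"
proof -
  interpret T: pair_graph T by fact
  obtain v v' where v: "v \<in> diagonal_part" "v' \<in> diagonal_part" "v * v' = 1" "v' * v = 1"
      "\<forall>l \<in> diagonal_part. v * l = l * v"
    and \<psi>_eq: "\<psi> = (\<lambda>a. v' * a * v)"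
    using \<psi> by (auto simp: fractional_automorphisms_def)
  define d d' where "d x = entry v x x" and "d' x = entry v' x x" for x
  have v_eq: "v = diagonal d" and v'_eq: "v' = diagonal d'"
    unfolding d_def d'_def by (rule diagonal_part_eq_diagonal, fact)+
  have inv: "d x * d' x = 1" "d' x * d x = 1" for x
    using v(3,4) unfolding v_eq v'_eq by (simp_all add: diagonal_times_diagonal diagonal_eq_1_iff)
  have central: "d x * r = r * d x" for x r
    unfolding d_def by (rule diagonal_central_imp_entry_central[OF v(5)])
  have entry: "entry (\<psi> f) x y = d' x * entry f x y * d y" for f x y
    by (simp add: \<psi>_eq v_eq v'_eq entry_diagonal_times entry_times_diagonal)
  have edge: "d x = d y" if "(x, y) \<in> parcs T" "x < y" for x y
  proof -
    have "d' x * d y = 1"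
      using fixed[OF that] entry[of "incidence_unit x y" x y] less_imp_le[OF \<open>x < y\<close>]
      by (simp add: incidence_unit.rep_eq)
    then show ?thesis
      by (metis inv(1) mult.assoc mult_1 mult_1_right)
  qed
  have "d x = d y" if "(x, y) \<in> parcs T" for x y
    using comparable[OF that] edge that arcs_ends_symmetric[OF T.sym_arcs]
    by (metis with_proj_simps(3))
  then have "d x = d y" for x y
    using T.connected_imp_constant[OF assms(2)] assms(3) by blast
  then have "entry (\<psi> f) x y = entry f x y" for f x y
    unfolding entry by (metis central inv(2) mult.assoc mult_1_right)
  then show ?thesis
    by (auto intro!: incidence_eqI)
qed

text \<open>Along the tree the multipliers of \<open>\<psi>\<close>, extended to the reversed arcs by their inverses, are the
  coboundary of a potential \<open>v\<close> with central values. Conjugation by the inverse of \<open>v\<close> cancels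
  them.\<close>

lemma multiplicative_automorphism_tree_normalization:
  fixes scale :: "'k::comm_ring_1 \<Rightarrow> 'r::ring_1 \<Rightarrow> 'r"
    and \<psi> :: "('x::{finite, order}, 'r) incidence \<Rightarrow> ('x, 'r) incidence"
  assumes "ring_algebra scale"
    and "pair_graph T" "Digraph_Component.connected (with_proj T)" "pverts T = UNIV"
    and acyclic: "\<nexists>p. pre_digraph.cycle (with_proj T) p \<and> 3 \<le> length p"
    and comparable: "\<And>x y. (x, y) \<in> parcs T \<Longrightarrow> x < y \<or> y < x"
    and \<psi>: "\<psi> \<in> multiplicative_automorphisms scale"
  obtains \<phi> \<theta> where "\<phi> \<in> fractional_automorphisms scale" "\<theta> \<in> multiplicative_automorphisms scale"
    "\<And>x y. (x, y) \<in> parcs T \<Longrightarrow> x < y \<Longrightarrow> \<theta> (incidence_unit x y) = incidence_unit x y"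
    "\<psi> = \<phi> \<circ> \<theta>"
proof -
  interpret ring_algebra scale by fact
  interpret T: pair_graph T by fact
  define c where "c = multiplier \<psi>"
  define C where "C = {z :: 'r. \<forall>r. r * z = z * r}"
  have c_C: "c x y \<in> C" for x y
    unfolding C_def c_def using multiplier_central[OF \<psi>] by blast
  obtain d where d: "\<And>x y. x \<le> y \<Longrightarrow> d x y * c x y = 1"
    using multiplier_left_inverse[OF \<psi>] unfolding c_def by metis
  have c_comm: "r * c x y = c x y * r" for r x y
    using c_C[of x y] unfolding C_def by blast
  have d': "c x y * d x y = 1" if "x \<le> y" for x y
    using d[OF that] by (simp only: c_comm)
  \<comment> \<open>The inverse of a central element is central.\<close>
  have d_C: "d x y \<in> C" if "x \<le> y" for x y
  proof -
    have "r * d x y = d x y * r" for r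
    proof -
      have "r * d x y = d x y * c x y * r * d x y"
        using d[OF that] by simp
      also have "\<dots> = d x y * r * (c x y * d x y)"
        by (metis c_comm mult.assoc)
      finally show ?thesis
        using d'[OF that] by simp
    qed
    then show ?thesis by (simp add: C_def)
  qed
  define g where "g = (\<lambda>(x, y). if x < y then c x y else d y x)"
  have g_inv: "g (x, y) * g (y, x) = 1" if "(x, y) \<in> parcs T" for x y
    using comparable[OF that] d d' by (auto simp: g_def)
  have g_C: "g e \<in> C" if "e \<in> parcs T" for e
    using comparable[of "fst e" "snd e"] that c_C d_C by (auto simp: g_def split: prod.splits)
  have C1: "1 \<in> C"
    by (simp add: C_def)
  have Cm: "a * b \<in> C" if "a \<in> C" "b \<in> C" for a b
    using that unfolding C_def mem_Collect_eq by (metis mult.assoc)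
  obtain v w where vw_T: "\<forall>x \<in> pverts T. v x \<in> C \<and> w x \<in> C \<and> v x * w x = 1 \<and> w x * v x = 1"
    and v: "\<forall>(x, y) \<in> parcs T. v y = v x * g (x, y)"
    by (rule T.tree_potential[where g = g and S = C, OF assms(3) acyclic g_inv C1 Cm g_C])
  have v_C: "v x \<in> C" and w_C: "w x \<in> C" and vw: "v x * w x = 1" "w x * v x = 1" for x
    using vw_T by (simp_all add: assms(4))
  define \<phi> where "\<phi> a = diagonal w * a * diagonal v" for a
  define \<chi> where "\<chi> a = diagonal v * a * diagonal w" for a
  have \<phi>: "\<phi> \<in> fractional_automorphisms scale"
    using conjugation_in_fractional_automorphisms[of v w] vw v_C
    unfolding \<phi>_def[abs_def] C_def by simp
  have "\<chi> \<in> fractional_automorphisms scale"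
    using conjugation_in_fractional_automorphisms[of w v] vw w_C
    unfolding \<chi>_def[abs_def] C_def by simp
  then have \<theta>: "\<chi> \<circ> \<psi> \<in> multiplicative_automorphisms scale"
    using fractional_automorphisms_subset \<psi> by (blast intro: multiplicative_automorphisms_comp)
  have "(\<chi> \<circ> \<psi>) (incidence_unit x y) = incidence_unit x y" if "(x, y) \<in> parcs T" "x < y" for x y
  proof -
    have "v y = v x * c x y"
      using v that by (auto simp: g_def)
    then have "v x * c x y * w y = 1"
      using vw(1)[of y] by simp
    then have "multiplier (\<chi> \<circ> \<psi>) x y = 1"
      by (simp add: multiplier_def \<chi>_def entry_diagonal_times entry_times_diagonal c_def)
    then show ?thesis
      using multiplicative_automorphism_fixes_unit_iff[OF \<theta>] \<open>x < y\<close> by auto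
  qed
  moreover have "\<psi> = \<phi> \<circ> (\<chi> \<circ> \<psi>)"
  proof
    fix a
    have "diagonal w * diagonal v = (1 :: ('x, 'r) incidence)"
      using vw by (simp add: diagonal_times_diagonal diagonal_eq_1_iff)
    then show "\<psi> a = (\<phi> \<circ> (\<chi> \<circ> \<psi>)) a"
      by (simp add: \<phi>_def \<chi>_def mult.assoc) (simp flip: mult.assoc)
  qed
  ultimately show thesis
    using that[OF \<phi> \<theta>] by blast
qed


section \<open>Multiplicative automorphisms and spanning trees\<close>

theorem corollary3p8:
  fixes scale :: "'k::comm_ring_1 \<Rightarrow> 'r::ring_1 \<Rightarrow> 'r"
    and T :: "'x::{finite, order} pair_pre_digraph"
  assumes "ring_algebra scale"
    and "Digraph_Component.connected (with_proj (poset_graph :: 'x pair_pre_digraph))"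
    and "graph_spanning_tree T (poset_graph :: 'x pair_pre_digraph)"
  shows "(multiplicative_automorphisms scale :: (('x, 'r) incidence \<Rightarrow> ('x, 'r) incidence) set)
           = fractional_automorphisms scale
    \<longleftrightarrow> (\<forall>\<psi> \<in> (multiplicative_automorphisms scale
                :: (('x, 'r) incidence \<Rightarrow> ('x, 'r) incidence) set).
          (\<forall>(x, y) \<in> parcs T. x < y \<longrightarrow> \<psi> (incidence_unit x y) = incidence_unit x y)
          \<longrightarrow> \<psi> = id)"
    (is "?Mult = ?Frac \<longleftrightarrow> ?rigid")
proof -
  have T: "pair_graph T" "Digraph_Component.connected (with_proj T)"
    and acyclic: "\<nexists>p. pre_digraph.cycle (with_proj T) p \<and> 3 \<le> length p"
    and span: "spanning (with_proj T) (with_proj (poset_graph :: 'x pair_pre_digraph))"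
    using assms(3) by (auto simp: graph_spanning_tree_def)
  have verts: "pverts T = UNIV"
    using span by (simp add: spanning_def poset_graph_def)
  have "parcs T \<subseteq> parcs poset_graph"
    using span by (auto simp: spanning_def subgraph_def)
  then have comparable: "x < y \<or> y < x" if "(x, y) \<in> parcs T" for x y
    using that by (auto simp: poset_graph_def order_less_le)
  show ?thesis
  proof
    assume eq: "?Mult = ?Frac"
    show ?rigid
    proof (intro ballI impI)
      fix \<psi> :: "('x, 'r) incidence \<Rightarrow> ('x, 'r) incidence"
      assume "\<psi> \<in> ?Mult"
        and "\<forall>(x, y) \<in> parcs T. x < y \<longrightarrow> \<psi> (incidence_unit x y) = incidence_unit x y"
      then show "\<psi> = id"
        using eq fractional_automorphism_fixing_connected_eq_id[OF T verts comparable, of \<psi> scale]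
        by blast
    qed
  next
    assume rigid: ?rigid
    have "\<psi> \<in> ?Frac" if \<psi>: "\<psi> \<in> ?Mult" for \<psi>
    proof -
      obtain \<phi> \<theta> where "\<phi> \<in> ?Frac" "\<theta> \<in> ?Mult" "\<psi> = \<phi> \<circ> \<theta>"
        and "\<And>x y. (x, y) \<in> parcs T \<Longrightarrow> x < y \<Longrightarrow> \<theta> (incidence_unit x y) = incidence_unit x y"
        using multiplicative_automorphism_tree_normalization
          [OF assms(1) T verts acyclic comparable \<psi>] by blast
      moreover from this have "\<theta> = id"
        using rigid by blast
      ultimately show ?thesis by simp
    qed
    then show "?Mult = ?Frac"
      using fractional_automorphisms_subset by blast
  qed
qed

end
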